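(* Let $\Gamma_r\subset\Omega_r=\{x\in\mathbb{R}^3:|x|=r\}$ be a subdomain of the sphere of radius $r>0$, let $M,N\geq 1$ be integers, let $\mathbb{R}^M$ be equipped with an inner product $\langle\cdot,\cdot\rangle_{\mathbb{R}^M}$ with corresponding norm $\|\cdot\|_{\mathbb{R}^M}$, and let $\mathrm{D}:L^2(\Gamma_r)\to\mathbb{R}^M$ be an operator (the discretization operator). Let $u^\dag\in L^2(\Gamma_r)$, and let $\xi\in\mathbb{R}^M$, $\varepsilon>0$ and $u_\xi^\dag\in L^2(\Gamma_r)$ be such that $$\mathrm{D}u_\xi^\dag=\mathrm{D}u^\dag+\xi,\qquad \left\|\mathrm{D}u^\dag-\mathrm{D}u_\xi^\dag\right\|_{\mathbb{R}^M}\leq\varepsilon .$$ Let $V\subset L^2(\Gamma_r)$ be a finite-dimensional linear subspace such that $$\langle g,\bar g\rangle_{L^2(\Gamma_r)}=\langle \mathrm{D}g,\mathrm{D}\bar g\rangle_{\mathbb{R}^M}\qquad\text{for all } g,\bar g\in V,$$ and let $\{u_k\}_{k=1,\ldots,N}\subset V$ be a finite family (of approximations of $u^\dag$). Let $k_{opt}\in\{1,\ldots,N\}$ be an index with $$\|u^\dag-u_{k_{opt}}\|_{L^2(\Gamma_r)}=\min_{k=1,\ldots,N}\|u^\dag-u_k\|_{L^2(\Gamma_r)},$$ and let $k_*\in\{1,\ldots,N\}$ be an index with $H_{k_*}=\min\{H_k: k=1,\ldots,N\}$, where the quantities $H_k$ (computed from $u_1,\ldots,u_N$ and $\mathrm{D}u_\xi^\dag$)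 are those defined in the context. Then $$\left\|u^\dag-u_{k_*}\right\|_{L^2(\Gamma_r)}\leq \left\|u^\dag-u_{k_{opt}}\right\|_{L^2(\Gamma_r)}+2\left\|\mathrm{D}u^\dag-\mathrm{D}u_{k_{opt}}\right\|_{\mathbb{R}^M}+2\varepsilon .$$
   Context: $L^2(\Gamma_r)$ is the real Hilbert space of square-integrable real-valued functions on $\Gamma_r$ with respect to surface measure. Given the family $\{u_k\}_{k=1,\ldots,N}\subset V$, the finite set $A_N\subset V$ is $$A_N=\left\{a_{k,l}=\frac{u_k-u_l}{\|u_k-u_l\|_{L^2(\Gamma_r)}}:\ k,l\in\{1,\ldots,N\},\ u_k\neq u_l\right\}.$$ For $k=1,\ldots,N$ and $a\in A_N$ set $$h_k(a)=\langle u_k,a\rangle_{L^2(\Gamma_r)}-\langle \mathrm{D}u_\xi^\dag,\mathrm{D}a\rangle_{\mathbb{R}^M},\qquad H_k=\max_{a\in A_N}|h_k(a)|,$$ with the convention $H_k=0$ for all $k$ if $A_N$ is empty (i.e. if all $u_k$ coincide). *)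

theory Defs
  imports "HOL-Analysis.Analysis"
begin

text \<open>
  Surface measure on the sphere \<open>{x. norm x = r}\<close> in three-space, by spherical coordinates
  \<open>(t, p)\<close> (polar angle, azimuth). The area element of this chart is \<open>r\<^sup>2 sin t\<close>; it
  misses only a half meridian, which has surface measure zero.
\<close>

definition sphere_chart :: "real \<Rightarrow> real \<times> real \<Rightarrow> real ^ 3" where
  "sphere_chart r = (\<lambda>(t, p). vector [r * (sin t * cos p), r * (sin t * sin p), r * cos t])"

definition sphere_measure :: "real \<Rightarrow> (real ^ 3) measure" where
  "sphere_measure r =
     distr (density lborel
              (\<lambda>(t, p). ennreal (r\<^sup>2 * sin t) * indicator ({0<..<pi} \<times> {0<..<2 * pi}) (t, p)))
       borel (sphere_chart r)"

definition surface_measure :: "real \<Rightarrow> (real ^ 3) set \<Rightarrow> (real ^ 3) measure" where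
  "surface_measure r \<Gamma> = restrict_space (sphere_measure r) \<Gamma>"

definition sphere_subdomain :: "real \<Rightarrow> (real ^ 3) set \<Rightarrow> bool" where
  "sphere_subdomain r \<Gamma> \<longleftrightarrow>
     openin (top_of_set (sphere 0 r)) \<Gamma> \<and> connected \<Gamma> \<and> \<Gamma> \<noteq> {}"


text \<open>
  The real Hilbert space \<open>L\<^sup>2(\<mu>)\<close>. Its points are equivalence classes of square-integrable
  functions modulo equality almost everywhere, so equality of points is equality in
  \<open>L\<^sup>2(\<mu>)\<close>. The operations are computed on chosen representatives; the lemmas below show that
  the choice is irrelevant.
\<close>

definition square_integrable :: "'a measure \<Rightarrow> ('a \<Rightarrow> real) set" where
  "square_integrable \<mu> = {f \<in> borel_measurable \<mu>. integrable \<mu> (\<lambda>x. (f x)\<^sup>2)}"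

definition ae_eq :: "'a measure \<Rightarrow> (('a \<Rightarrow> real) \<times> ('a \<Rightarrow> real)) set" where
  "ae_eq \<mu> = {(f, g). f \<in> square_integrable \<mu> \<and> g \<in> square_integrable \<mu> \<and> (AE x in \<mu>. f x = g x)}"

definition L2 :: "'a measure \<Rightarrow> ('a \<Rightarrow> real) set set" where
  "L2 \<mu> = square_integrable \<mu> // ae_eq \<mu>"

definition L2_class :: "'a measure \<Rightarrow> ('a \<Rightarrow> real) \<Rightarrow> ('a \<Rightarrow> real) set" where
  "L2_class \<mu> f = ae_eq \<mu> `` {f}"

definition rep :: "('a \<Rightarrow> real) set \<Rightarrow> 'a \<Rightarrow> real" where
  "rep F = (SOME f. f \<in> F)"

definition L2_add :: "'a measure \<Rightarrow> ('a \<Rightarrow> real) set \<Rightarrow> ('a \<Rightarrow> real) set \<Rightarrow> ('a \<Rightarrow> real) set" where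
  "L2_add \<mu> F G = L2_class \<mu> (\<lambda>x. rep F x + rep G x)"

definition L2_diff :: "'a measure \<Rightarrow> ('a \<Rightarrow> real) set \<Rightarrow> ('a \<Rightarrow> real) set \<Rightarrow> ('a \<Rightarrow> real) set" where
  "L2_diff \<mu> F G = L2_class \<mu> (\<lambda>x. rep F x - rep G x)"

definition L2_scale :: "'a measure \<Rightarrow> real \<Rightarrow> ('a \<Rightarrow> real) set \<Rightarrow> ('a \<Rightarrow> real) set" where
  "L2_scale \<mu> c F = L2_class \<mu> (\<lambda>x. c * rep F x)"

definition L2_inner :: "'a measure \<Rightarrow> ('a \<Rightarrow> real) set \<Rightarrow> ('a \<Rightarrow> real) set \<Rightarrow> real" where
  "L2_inner \<mu> F G = (\<integral>x. rep F x * rep G x \<partial>\<mu>)"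

definition L2_norm :: "'a measure \<Rightarrow> ('a \<Rightarrow> real) set \<Rightarrow> real" where
  "L2_norm \<mu> F = sqrt (L2_inner \<mu> F F)"

definition L2_subspace :: "'a measure \<Rightarrow> ('a \<Rightarrow> real) set set \<Rightarrow> bool" where
  "L2_subspace \<mu> V \<longleftrightarrow> V \<subseteq> L2 \<mu> \<and> L2_class \<mu> (\<lambda>x. 0) \<in> V \<and>
     (\<forall>F\<in>V. \<forall>G\<in>V. L2_add \<mu> F G \<in> V) \<and> (\<forall>c. \<forall>F\<in>V. L2_scale \<mu> c F \<in> V)"

definition L2_finite_dim :: "'a measure \<Rightarrow> ('a \<Rightarrow> real) set set \<Rightarrow> bool" where
  "L2_finite_dim \<mu> V \<longleftrightarrow>
     (\<exists>B. finite B \<and> B \<subseteq> V \<and> (\<forall>F\<in>V. \<exists>c. F = L2_class \<mu> (\<lambda>x. \<Sum>G\<in>B. c G * rep G x)))"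


definition inner_product :: "('b::real_vector \<Rightarrow> 'b \<Rightarrow> real) \<Rightarrow> bool" where
  "inner_product ip \<longleftrightarrow>
     bilinear ip \<and> (\<forall>x y. ip x y = ip y x) \<and> (\<forall>x. x \<noteq> 0 \<longrightarrow> ip x x > 0)"

definition ip_norm :: "('b \<Rightarrow> 'b \<Rightarrow> real) \<Rightarrow> 'b \<Rightarrow> real" where
  "ip_norm ip x = sqrt (ip x x)"


definition A_set ::
    "'a measure \<Rightarrow> nat \<Rightarrow> (nat \<Rightarrow> ('a \<Rightarrow> real) set) \<Rightarrow> ('a \<Rightarrow> real) set set" where
  "A_set \<mu> N u =
     {L2_scale \<mu> (1 / L2_norm \<mu> (L2_diff \<mu> (u k) (u l))) (L2_diff \<mu> (u k) (u l)) | k l.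
        k \<in> {1..N} \<and> l \<in> {1..N} \<and> u k \<noteq> u l}"

definition h_fun ::
    "'a measure \<Rightarrow> ('b \<Rightarrow> 'b \<Rightarrow> real) \<Rightarrow> (('a \<Rightarrow> real) set \<Rightarrow> 'b) \<Rightarrow>
     (nat \<Rightarrow> ('a \<Rightarrow> real) set) \<Rightarrow> ('a \<Rightarrow> real) set \<Rightarrow> nat \<Rightarrow> ('a \<Rightarrow> real) set \<Rightarrow> real" where
  "h_fun \<mu> ip D u u\<xi> k a = L2_inner \<mu> (u k) a - ip (D u\<xi>) (D a)"

definition H_val ::
    "'a measure \<Rightarrow> ('b \<Rightarrow> 'b \<Rightarrow> real) \<Rightarrow> (('a \<Rightarrow> real) set \<Rightarrow> 'b) \<Rightarrow> nat \<Rightarrow>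
     (nat \<Rightarrow> ('a \<Rightarrow> real) set) \<Rightarrow> ('a \<Rightarrow> real) set \<Rightarrow> nat \<Rightarrow> real" where
  "H_val \<mu> ip D N u u\<xi> k =
     (if A_set \<mu> N u = {} then 0 else Max ((\<lambda>a. \<bar>h_fun \<mu> ip D u u\<xi> k a\<bar>) ` A_set \<mu> N u))"


lemma sphere_chart_measurable: "sphere_chart r \<in> borel_measurable borel"
proof -
  have "sphere_chart r = (\<lambda>q. (r * (sin (fst q) * cos (snd q))) *\<^sub>R axis 1 1 +
      (r * (sin (fst q) * sin (snd q))) *\<^sub>R axis 2 1 + (r * cos (fst q)) *\<^sub>R axis 3 1)"
    by (auto simp: sphere_chart_def vec_eq_iff forall_3 axis_def case_prod_unfold)
  then have "continuous_on UNIV (sphere_chart r)"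
    by (simp only:) (intro continuous_intros)
  then show ?thesis by (rule borel_measurable_continuous_onI)
qed

lemma equiv_ae_eq: "equiv (square_integrable \<mu>) (ae_eq \<mu>)"
  by (rule equivI) (auto simp: ae_eq_def refl_on_def sym_def trans_def)

lemma square_integrable_mult:
  assumes "f \<in> square_integrable \<mu>" "g \<in> square_integrable \<mu>"
  shows "integrable \<mu> (\<lambda>x. f x * g x)"
proof (rule Bochner_Integration.integrable_bound[where f = "\<lambda>x. (f x)\<^sup>2 + (g x)\<^sup>2"])
  show "integrable \<mu> (\<lambda>x. (f x)\<^sup>2 + (g x)\<^sup>2)" "(\<lambda>x. f x * g x) \<in> borel_measurable \<mu>"
    using assms by (auto simp: square_integrable_def)
  have "\<bar>a * b\<bar> \<le> a\<^sup>2 + b\<^sup>2" for a b :: real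
  proof -
    have "2 * (\<bar>a\<bar> * \<bar>b\<bar>) \<le> a\<^sup>2 + b\<^sup>2"
      using sum_squares_bound[of "\<bar>a\<bar>" "\<bar>b\<bar>"] by simp
    moreover have "0 \<le> \<bar>a\<bar> * \<bar>b\<bar>" by simp
    ultimately show ?thesis unfolding abs_mult by linarith
  qed
  then show "AE x in \<mu>. norm (f x * g x) \<le> norm ((f x)\<^sup>2 + (g x)\<^sup>2)"
    by auto
qed

lemma square_integrable_zero: "(\<lambda>x. 0) \<in> square_integrable \<mu>"
  by (simp add: square_integrable_def)

lemma square_integrable_scale:
  "f \<in> square_integrable \<mu> \<Longrightarrow> (\<lambda>x. c * f x) \<in> square_integrable \<mu>"
  by (auto simp: square_integrable_def power_mult_distrib)

lemma square_integrable_add: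
  assumes "f \<in> square_integrable \<mu>" "g \<in> square_integrable \<mu>"
  shows "(\<lambda>x. f x + g x) \<in> square_integrable \<mu>"
proof -
  have "integrable \<mu> (\<lambda>x. (f x)\<^sup>2 + (g x)\<^sup>2 + 2 * (f x * g x))"
    using assms square_integrable_mult[OF assms] by (auto simp: square_integrable_def)
  then show ?thesis
    using assms by (auto simp: square_integrable_def power2_sum algebra_simps)
qed

lemma square_integrable_diff:
  assumes "f \<in> square_integrable \<mu>" "g \<in> square_integrable \<mu>"
  shows "(\<lambda>x. f x - g x) \<in> square_integrable \<mu>"
  using square_integrable_add[OF assms(1) square_integrable_scale[OF assms(2), of "-1"]] by simp

lemma L2_class_in_L2: "f \<in> square_integrable \<mu> \<Longrightarrow> L2_class \<mu> f \<in> L2 \<mu>"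
  by (simp add: L2_def L2_class_def quotientI)

lemma L2_class_eq_iff:
  "f \<in> square_integrable \<mu> \<Longrightarrow> g \<in> square_integrable \<mu> \<Longrightarrow>
   L2_class \<mu> f = L2_class \<mu> g \<longleftrightarrow> (AE x in \<mu>. f x = g x)"
  unfolding L2_class_def using eq_equiv_class_iff[OF equiv_ae_eq] by (auto simp: ae_eq_def)

lemma L2_cases:
  assumes "F \<in> L2 \<mu>"
  obtains f where "f \<in> square_integrable \<mu>" "F = L2_class \<mu> f"
  using assms unfolding L2_def L2_class_def by (auto elim: quotientE)

lemma rep_L2_class:
  assumes "f \<in> square_integrable \<mu>"
  shows "rep (L2_class \<mu> f) \<in> square_integrable \<mu>" "AE x in \<mu>. rep (L2_class \<mu> f) x = f x"
proof -
  have "f \<in> L2_class \<mu> f" using assms by (simp add: L2_class_def ae_eq_def)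
  then have "rep (L2_class \<mu> f) \<in> L2_class \<mu> f" 
    unfolding rep_def by (rule someI[of "\<lambda>g. g \<in> L2_class \<mu> f"])
  then show "rep (L2_class \<mu> f) \<in> square_integrable \<mu>" "AE x in \<mu>. rep (L2_class \<mu> f) x = f x"
    by (auto simp: L2_class_def ae_eq_def)
qed

lemma rep_L2: "F \<in> L2 \<mu> \<Longrightarrow> rep F \<in> square_integrable \<mu>"
  by (metis L2_cases rep_L2_class(1))

lemma L2_class_rep: "F \<in> L2 \<mu> \<Longrightarrow> L2_class \<mu> (rep F) = F"
  by (metis L2_cases L2_class_eq_iff rep_L2_class)

lemma L2_add_class:
  assumes "f \<in> square_integrable \<mu>" "g \<in> square_integrable \<mu>"
  shows "L2_add \<mu> (L2_class \<mu> f) (L2_class \<mu> g) = L2_class \<mu> (\<lambda>x. f x + g x)"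
  unfolding L2_add_def using rep_L2_class[OF assms(1)] rep_L2_class[OF assms(2)]
  by (subst L2_class_eq_iff) (auto intro: square_integrable_add assms)

lemma L2_diff_class:
  assumes "f \<in> square_integrable \<mu>" "g \<in> square_integrable \<mu>"
  shows "L2_diff \<mu> (L2_class \<mu> f) (L2_class \<mu> g) = L2_class \<mu> (\<lambda>x. f x - g x)"
  unfolding L2_diff_def using rep_L2_class[OF assms(1)] rep_L2_class[OF assms(2)]
  by (subst L2_class_eq_iff) (auto intro: square_integrable_diff assms)

lemma L2_scale_class:
  assumes "f \<in> square_integrable \<mu>"
  shows "L2_scale \<mu> c (L2_class \<mu> f) = L2_class \<mu> (\<lambda>x. c * f x)"
  unfolding L2_scale_def using rep_L2_class[OF assms]
  by (subst L2_class_eq_iff) (auto intro: square_integrable_scale assms)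

lemma L2_inner_class:
  assumes "f \<in> square_integrable \<mu>" "g \<in> square_integrable \<mu>"
  shows "L2_inner \<mu> (L2_class \<mu> f) (L2_class \<mu> g) = (\<integral>x. f x * g x \<partial>\<mu>)"
  unfolding L2_inner_def
proof (rule integral_cong_AE)
  show "AE x in \<mu>. rep (L2_class \<mu> f) x * rep (L2_class \<mu> g) x = f x * g x"
    using rep_L2_class(2)[OF assms(1)] rep_L2_class(2)[OF assms(2)] by auto
qed (use assms rep_L2_class(1)[OF assms(1)] rep_L2_class(1)[OF assms(2)]
     in \<open>auto simp: square_integrable_def\<close>)

end

theory Submission imports Defs begin

text \<open>
  If \<open>u k\<^sub>s \<noteq> u k\<^sub>o\<^sub>p\<^sub>t\<close>, their normalised difference \<open>a\<close> belongs to \<open>A\<^sub>N\<close>, and the noisy term of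
  \<open>h\<close> cancels in \<open>\<parallel>u k\<^sub>s - u k\<^sub>o\<^sub>p\<^sub>t\<parallel> = h k\<^sub>s a - h k\<^sub>o\<^sub>p\<^sub>t a \<le> H k\<^sub>s + H k\<^sub>o\<^sub>p\<^sub>t \<le> 2 H k\<^sub>o\<^sub>p\<^sub>t\<close>. Since \<open>D\<close> is
  isometric on \<open>V\<close>, \<open>h k a\<close> is the inner product of \<open>D (u k) - D u\<xi>\<close> with the unit vector \<open>D a\<close>, so
  Cauchy-Schwarz bounds \<open>H k\<^sub>o\<^sub>p\<^sub>t\<close> by the distance of \<open>D (u k\<^sub>o\<^sub>p\<^sub>t)\<close> to \<open>D u\<xi>\<close>.
\<close>

section \<open>Scalar inequalities behind Cauchy-Schwarz and the triangle inequality\<close>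

text \<open>Discriminant argument. It is phrased for real coefficients so that it serves both
  \<open>ip\<close> and \<open>L2_inner\<close>, the latter living on a set of classes and not on a
  type.\<close>

lemma nonneg_quadratic_imp_sqrt_bound:
  fixes a b c :: real
  assumes nonneg: "\<And>t. 0 \<le> a + 2 * t * b + t\<^sup>2 * c" and "0 \<le> c"
  shows "\<bar>b\<bar> \<le> sqrt a * sqrt c"
proof -
  have "b\<^sup>2 \<le> a * c"
  proof (cases "c = 0")
    case True
    have "b = 0"
    proof (rule ccontr)
      assume "b \<noteq> 0"
      \<comment> \<open>For \<open>c = 0\<close> the polynomial is affine with slope
        \<open>2 * b\<close>, and this \<open>t\<close> gives it the value -1.\<close>
      then show False
        using nonneg[of "- (a + 1) / (2 * b)"] True by (simp add: field_simps)
    qed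
    then show ?thesis using True by simp
  next
    case False
    then have "0 < c" using \<open>0 \<le> c\<close> by simp
    \<comment> \<open>The minimiser of the quadratic, where its value is
      \<open>a - b\<^sup>2 / c\<close>.\<close>
    then show ?thesis
      using nonneg[of "- b / c"] by (simp add: field_simps power2_eq_square)
  qed
  then have "sqrt (b\<^sup>2) \<le> sqrt (a * c)" by (rule real_sqrt_le_mono)
  then show ?thesis by (simp add: real_sqrt_mult)
qed

text \<open>Scalar core of the triangle inequality: \<open>a\<close> and \<open>c\<close> stand for
  squared norms and \<open>b\<close> for the inner product.\<close>

lemma sqrt_add_le_of_cross_term:
  fixes a b c :: real
  assumes "\<bar>b\<bar> \<le> sqrt a * sqrt c" "0 \<le> a" "0 \<le> c"
  shows "sqrt (a + 2 * b + c) \<le> sqrt a + sqrt c"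
proof (rule real_le_lsqrt)
  show "0 \<le> sqrt a + sqrt c" using assms by simp
  show "a + 2 * b + c \<le> (sqrt a + sqrt c)\<^sup>2"
    using assms by (simp add: power2_sum)
qed

section \<open>Inner product on the data space\<close>

lemma
  assumes "inner_product ip"
  shows inner_product_nonneg: "0 \<le> ip x x"
    and inner_product_add_scale:
      "ip (x + t *\<^sub>R y) (x + t *\<^sub>R y) = ip x x + 2 * t * ip x y + t\<^sup>2 * ip y y"
    and inner_product_diff_left: "ip (x - y) z = ip x z - ip y z"
proof -
  have bil: "bilinear ip" and sym: "ip y x = ip x y"
    using assms unfolding inner_product_def by blast+
  \<comment> \<open>The definition gives positivity only for nonzero \<open>x\<close>; at 0 the
    value comes from bilinearity.\<close>
  show "0 \<le> ip x x"
    using assms bilinear_lzero[OF bil] unfolding inner_product_def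
    by (cases "x = 0") (auto intro: less_imp_le)
  show "ip (x + t *\<^sub>R y) (x + t *\<^sub>R y) = ip x x + 2 * t * ip x y + t\<^sup>2 * ip y y"
    by (simp add: bilinear_ladd[OF bil] bilinear_radd[OF bil] bilinear_lmul[OF bil]
        bilinear_rmul[OF bil] sym power2_eq_square algebra_simps)
  show "ip (x - y) z = ip x z - ip y z"
    by (rule bilinear_lsub[OF bil])
qed

text \<open>The quadratic is \<open>t \<mapsto> ip (x + t *\<^sub>R y) (x + t *\<^sub>R y)\<close>,
  recognised by reading its expansion from right to left.\<close>

lemma inner_product_Cauchy_Schwarz:
  assumes "inner_product ip"
  shows "\<bar>ip x y\<bar> \<le> ip_norm ip x * ip_norm ip y"
  unfolding ip_norm_def
  by (intro nonneg_quadratic_imp_sqrt_bound)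
    (simp_all add: inner_product_nonneg[OF assms] flip: inner_product_add_scale[OF assms])

lemma ip_norm_triangle:
  assumes "inner_product ip"
  shows "ip_norm ip (x + y) \<le> ip_norm ip x + ip_norm ip y"
  using sqrt_add_le_of_cross_term[OF inner_product_Cauchy_Schwarz[OF assms, of x y, unfolded ip_norm_def]]
    inner_product_nonneg[OF assms] inner_product_add_scale[OF assms, of x 1 y]
  by (simp add: ip_norm_def)

lemma ip_norm_minus_commute:
  assumes "inner_product ip"
  shows "ip_norm ip (x - y) = ip_norm ip (y - x)"
proof -
  have "bilinear ip" using assms unfolding inner_product_def by blast
  then have "ip (- (y - x)) (- (y - x)) = ip (y - x) (y - x)"
    by (simp only: bilinear_lneg bilinear_rneg minus_minus)
  then show ?thesis by (simp add: ip_norm_def)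
qed

section \<open>Hilbert space geometry of L2 classes\<close>

lemma L2_inner_commute: "L2_inner \<mu> F G = L2_inner \<mu> G F"
  by (simp add: L2_inner_def mult.commute)

lemma L2_inner_nonneg: "0 \<le> L2_inner \<mu> F F"
  by (simp add: L2_inner_def)

lemma L2_diff_in_L2: "F \<in> L2 \<mu> \<Longrightarrow> G \<in> L2 \<mu> \<Longrightarrow> L2_diff \<mu> F G \<in> L2 \<mu>"
  unfolding L2_diff_def by (intro L2_class_in_L2 square_integrable_diff rep_L2)

text \<open>On representatives this is linearity of the integral;
  \<open>square_integrable_mult\<close> supplies the integrability needed to split it.\<close>

lemma L2_inner_add_left:
  assumes "F \<in> L2 \<mu>" "G \<in> L2 \<mu>" "H \<in> L2 \<mu>"
  shows "L2_inner \<mu> (L2_add \<mu> F G) H = L2_inner \<mu> F H + L2_inner \<mu> G H"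
  using assms
  by (elim L2_cases) (simp add: L2_add_class L2_inner_class square_integrable_add
      square_integrable_mult distrib_right)

lemma L2_inner_diff_left:
  assumes "F \<in> L2 \<mu>" "G \<in> L2 \<mu>" "H \<in> L2 \<mu>"
  shows "L2_inner \<mu> (L2_diff \<mu> F G) H = L2_inner \<mu> F H - L2_inner \<mu> G H"
  using assms
  by (elim L2_cases) (simp add: L2_diff_class L2_inner_class square_integrable_diff
      square_integrable_mult left_diff_distrib)

lemma L2_inner_scale_left:
  assumes "F \<in> L2 \<mu>" "G \<in> L2 \<mu>"
  shows "L2_inner \<mu> (L2_scale \<mu> c F) G = c * L2_inner \<mu> F G"
  using assms
  by (elim L2_cases) (simp add: L2_scale_class L2_inner_class square_integrable_scale mult.assoc)

lemma L2_add_in_L2: "F \<in> L2 \<mu> \<Longrightarrow> G \<in> L2 \<mu> \<Longrightarrow> L2_add \<mu> F G \<in> L2 \<mu>"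
  unfolding L2_add_def by (intro L2_class_in_L2 square_integrable_add rep_L2)

lemma L2_scale_in_L2: "F \<in> L2 \<mu> \<Longrightarrow> L2_scale \<mu> c F \<in> L2 \<mu>"
  unfolding L2_scale_def by (intro L2_class_in_L2 square_integrable_scale rep_L2)

lemma L2_inner_add_scale:
  assumes "F \<in> L2 \<mu>" "G \<in> L2 \<mu>"
  defines "H \<equiv> \<lambda>t. L2_add \<mu> F (L2_scale \<mu> t G)"
  shows "L2_inner \<mu> (H t) (H t) = L2_inner \<mu> F F + 2 * t * L2_inner \<mu> F G + t\<^sup>2 * L2_inner \<mu> G G"
proof -
  \<comment> \<open>Linearity in the left argument is used twice: with \<open>K = H t\<close>, and
    after commuting with \<open>K = F\<close> and \<open>K = G\<close>.\<close>
  have lin: "L2_inner \<mu> (H t) K = L2_inner \<mu> F K + t * L2_inner \<mu> G K" if "K \<in> L2 \<mu>" for K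
    using assms(1,2) that by (simp add: H_def L2_inner_add_left L2_inner_scale_left L2_scale_in_L2)
  have "H t \<in> L2 \<mu>" using assms(1,2) by (simp add: H_def L2_add_in_L2 L2_scale_in_L2)
  then have "L2_inner \<mu> (H t) (H t) = L2_inner \<mu> (H t) F + t * L2_inner \<mu> (H t) G"
    using lin[of "H t"] by (simp add: L2_inner_commute[of \<mu> F "H t"] L2_inner_commute[of \<mu> G "H t"])
  also have "\<dots> = L2_inner \<mu> F F + 2 * t * L2_inner \<mu> F G + t\<^sup>2 * L2_inner \<mu> G G"
    using assms(1,2)
    by (simp add: lin L2_inner_commute[of \<mu> G F] power2_eq_square algebra_simps)
  finally show ?thesis .
qed

lemma L2_Cauchy_Schwarz:
  assumes "F \<in> L2 \<mu>" "G \<in> L2 \<mu>"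
  shows "\<bar>L2_inner \<mu> F G\<bar> \<le> L2_norm \<mu> F * L2_norm \<mu> G"
  unfolding L2_norm_def
  by (intro nonneg_quadratic_imp_sqrt_bound)
    (simp_all add: L2_inner_nonneg flip: L2_inner_add_scale[OF assms])

lemma L2_scale_one: "F \<in> L2 \<mu> \<Longrightarrow> L2_scale \<mu> 1 F = F"
  by (simp add: L2_scale_def L2_class_rep)

lemma L2_norm_triangle:
  assumes "F \<in> L2 \<mu>" "G \<in> L2 \<mu>"
  shows "L2_norm \<mu> (L2_add \<mu> F G) \<le> L2_norm \<mu> F + L2_norm \<mu> G"
  using sqrt_add_le_of_cross_term[OF L2_Cauchy_Schwarz[OF assms, unfolded L2_norm_def]]
    L2_inner_add_scale[OF assms, of 1] assms
  by (simp add: L2_norm_def L2_inner_nonneg L2_scale_one)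

lemma L2_norm_diff_triangle:
  assumes "F \<in> L2 \<mu>" "G \<in> L2 \<mu>" "H \<in> L2 \<mu>"
  shows "L2_norm \<mu> (L2_diff \<mu> F H) \<le> L2_norm \<mu> (L2_diff \<mu> F G) + L2_norm \<mu> (L2_diff \<mu> G H)"
proof -
  \<comment> \<open>Telescoping through \<open>G\<close>, checked on representatives.\<close>
  have "L2_diff \<mu> F H = L2_add \<mu> (L2_diff \<mu> F G) (L2_diff \<mu> G H)"
    using assms by (elim L2_cases) (simp add: L2_diff_class L2_add_class square_integrable_diff)
  then show ?thesis
    using assms by (simp add: L2_norm_triangle L2_diff_in_L2)
qed

text \<open>A nonnegative function with zero integral vanishes almost everywhere, and almost
  everywhere equality is equality of classes. Hence the divisors in \<open>A_set\<close> are
  nonzero.\<close>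

lemma L2_norm_diff_eq_0_iff:
  assumes "F \<in> L2 \<mu>" "G \<in> L2 \<mu>"
  shows "L2_norm \<mu> (L2_diff \<mu> F G) = 0 \<longleftrightarrow> F = G"
proof -
  obtain f g where f: "f \<in> square_integrable \<mu>" "F = L2_class \<mu> f"
    and g: "g \<in> square_integrable \<mu>" "G = L2_class \<mu> g"
    using assms by (elim L2_cases)
  note d = square_integrable_diff[OF f(1) g(1)]
  have "L2_norm \<mu> (L2_diff \<mu> F G) = 0 \<longleftrightarrow> (\<integral>x. (f x - g x) * (f x - g x) \<partial>\<mu>) = 0"
    by (simp add: f g d L2_norm_def L2_diff_class L2_inner_class)
  also have "\<dots> \<longleftrightarrow> (AE x in \<mu>. (f x - g x) * (f x - g x) = 0)"
    by (intro integral_nonneg_eq_0_iff_AE square_integrable_mult d) simp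
  also have "\<dots> \<longleftrightarrow> F = G"
    using f g by (simp add: L2_class_eq_iff)
  finally show ?thesis .
qed

lemma L2_norm_normalized:
  assumes "F \<in> L2 \<mu>" "L2_norm \<mu> F \<noteq> 0"
  shows "L2_norm \<mu> (L2_scale \<mu> (1 / L2_norm \<mu> F) F) = 1"
proof -
  have "L2_inner \<mu> F F = (L2_norm \<mu> F)\<^sup>2"
    by (simp add: L2_norm_def L2_inner_nonneg)
  then show ?thesis
    using assms
    by (subst L2_norm_def) (simp add: L2_inner_scale_left L2_scale_in_L2
        L2_inner_commute[of \<mu> F "L2_scale \<mu> _ F"] power2_eq_square)
qed

text \<open>If the norm is 0, the convention \<open>1 / 0 = 0\<close> makes both sides 0.\<close>

lemma L2_inner_normalized:
  assumes "F \<in> L2 \<mu>"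
  shows "L2_inner \<mu> F (L2_scale \<mu> (1 / L2_norm \<mu> F) F) = L2_norm \<mu> F"
proof -
  have "L2_inner \<mu> F F = (L2_norm \<mu> F)\<^sup>2"
    by (simp add: L2_norm_def L2_inner_nonneg)
  then show ?thesis
    using assms
    by (simp add: L2_inner_commute[of \<mu> F "L2_scale \<mu> _ F"] L2_inner_scale_left power2_eq_square)
qed

lemma L2_subspace_diff:
  assumes "L2_subspace \<mu> V" "F \<in> V" "G \<in> V"
  shows "L2_diff \<mu> F G \<in> V"
proof -
  have "F \<in> L2 \<mu>" "G \<in> L2 \<mu>" using assms by (auto simp: L2_subspace_def)
  then have "L2_diff \<mu> F G = L2_add \<mu> F (L2_scale \<mu> (- 1) G)"
    by (elim L2_cases) (use square_integrable_scale[of _ \<mu> "- 1"] in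
        \<open>simp add: L2_diff_class L2_add_class L2_scale_class\<close>)
  then show ?thesis using assms by (simp add: L2_subspace_def)
qed

section \<open>The test set and the quantities H\<close>

text \<open>The index pairs are finite in number. This makes the \<open>Max\<close> in
  \<open>H_val\<close> a genuine maximum.\<close>

lemma finite_A_set: "finite (A_set \<mu> N u)"
proof (rule finite_subset)
  let ?a = "\<lambda>(k, l). L2_scale \<mu> (1 / L2_norm \<mu> (L2_diff \<mu> (u k) (u l))) (L2_diff \<mu> (u k) (u l))"
  show "A_set \<mu> N u \<subseteq> ?a ` ({1..N} \<times> {1..N})"
    unfolding A_set_def by auto
qed simp

lemma A_set_mem:
  assumes "L2_subspace \<mu> V" "\<And>k. k \<in> {1..N} \<Longrightarrow> u k \<in> V" "a \<in> A_set \<mu> N u"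
  shows "a \<in> V" "L2_norm \<mu> a = 1"
proof -
  obtain k l where kl: "k \<in> {1..N}" "l \<in> {1..N}" "u k \<noteq> u l"
    and a: "a = L2_scale \<mu> (1 / L2_norm \<mu> (L2_diff \<mu> (u k) (u l))) (L2_diff \<mu> (u k) (u l))"
    using assms(3) unfolding A_set_def by blast
  have V: "u k \<in> V" "u l \<in> V" using assms(2) kl by auto
  then have L2: "u k \<in> L2 \<mu>" "u l \<in> L2 \<mu>" using assms(1) by (auto simp: L2_subspace_def)
  show "a \<in> V"
    using L2_subspace_diff[OF assms(1) V] assms(1) by (simp add: a L2_subspace_def)
  show "L2_norm \<mu> a = 1"
    using L2 kl(3) by (simp add: a L2_norm_normalized L2_diff_in_L2 L2_norm_diff_eq_0_iff)
qed

lemma abs_h_fun_le_H_val: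
  "a \<in> A_set \<mu> N u \<Longrightarrow> \<bar>h_fun \<mu> ip D u u\<xi> k a\<bar> \<le> H_val \<mu> ip D N u u\<xi> k"
  by (auto simp: H_val_def finite_A_set)

lemma H_val_le_ip_norm:
  assumes ip: "inner_product ip" and V: "L2_subspace \<mu> V"
    and iso: "\<And>g g'. g \<in> V \<Longrightarrow> g' \<in> V \<Longrightarrow> L2_inner \<mu> g g' = ip (D g) (D g')"
    and u: "\<And>k. k \<in> {1..N} \<Longrightarrow> u k \<in> V"
    and k: "k \<in> {1..N}"
  shows "H_val \<mu> ip D N u u\<xi> k \<le> ip_norm ip (D (u k) - D u\<xi>)"
proof -
  have "\<bar>h_fun \<mu> ip D u u\<xi> k a\<bar> \<le> ip_norm ip (D (u k) - D u\<xi>)" if "a \<in> A_set \<mu> N u" for a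
  proof -
    note a = A_set_mem[OF V u that]
    \<comment> \<open>The isometry applies because \<open>u k\<close> and \<open>a\<close> lie in
      \<open>V\<close>. The difference is formed outside \<open>D\<close>, so only linearity of
      \<open>ip\<close> enters, not of \<open>D\<close>.\<close>
    have "h_fun \<mu> ip D u u\<xi> k a = ip (D (u k) - D u\<xi>) (D a)"
      using a u[OF k] by (simp add: h_fun_def iso inner_product_diff_left[OF ip])
    moreover have "ip_norm ip (D a) = 1"
      using a by (simp add: ip_norm_def L2_norm_def iso)
    ultimately show ?thesis
      using inner_product_Cauchy_Schwarz[OF ip, of "D (u k) - D u\<xi>" "D a"] by simp
  qed
  \<comment> \<open>Covers the convention that \<open>H_val\<close> is 0 when \<open>A_set\<close>
    is empty.\<close>
  moreover have "0 \<le> ip_norm ip (D (u k) - D u\<xi>)"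
    by (simp add: ip_norm_def inner_product_nonneg[OF ip])
  ultimately show ?thesis
    by (simp add: H_val_def finite_A_set)
qed

lemma L2_norm_diff_le_H_val:
  assumes V: "L2_subspace \<mu> V" and u: "\<And>k. k \<in> {1..N} \<Longrightarrow> u k \<in> V"
    and kl: "k \<in> {1..N}" "l \<in> {1..N}" "u k \<noteq> u l"
  shows "L2_norm \<mu> (L2_diff \<mu> (u k) (u l)) \<le> H_val \<mu> ip D N u u\<xi> k + H_val \<mu> ip D N u u\<xi> l"
proof -
  define d where "d = L2_diff \<mu> (u k) (u l)"
  define a where "a = L2_scale \<mu> (1 / L2_norm \<mu> d) d"
  have a: "a \<in> A_set \<mu> N u"
    using kl unfolding A_set_def a_def d_def by blast
  have L2: "u k \<in> L2 \<mu>" "u l \<in> L2 \<mu>" "a \<in> L2 \<mu>"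
    using u kl A_set_mem(1)[OF V u a] V by (auto simp: L2_subspace_def)
  have "L2_norm \<mu> d = L2_inner \<mu> d a"
    unfolding a_def d_def using L2 by (simp add: L2_inner_normalized L2_diff_in_L2)
  \<comment> \<open>Both values of \<open>h_fun\<close> subtract the same number
    \<open>ip (D u\<xi>) (D a)\<close>.\<close>
  also have "\<dots> = h_fun \<mu> ip D u u\<xi> k a - h_fun \<mu> ip D u u\<xi> l a"
    using L2 by (simp add: d_def h_fun_def L2_inner_diff_left)
  also have "\<dots> \<le> H_val \<mu> ip D N u u\<xi> k + H_val \<mu> ip D N u u\<xi> l"
    using abs_h_fun_le_H_val[OF a, of ip D u\<xi> k] abs_h_fun_le_H_val[OF a, of ip D u\<xi> l]
    by linarith
  finally show ?thesis unfolding d_def .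
qed

theorem theorem2p2:
  fixes r \<epsilon> :: real
    and N k\<^sub>o\<^sub>p\<^sub>t k\<^sub>s :: nat
    and \<Gamma> :: "(real ^ 3) set"
    and \<mu> :: "(real ^ 3) measure"
    and ip :: "real ^ 'm \<Rightarrow> real ^ 'm \<Rightarrow> real"
    and D :: "(real ^ 3 \<Rightarrow> real) set \<Rightarrow> real ^ 'm"
    and u\<^sub>0 u\<xi> :: "(real ^ 3 \<Rightarrow> real) set"
    and \<xi> :: "real ^ 'm"
    and V :: "(real ^ 3 \<Rightarrow> real) set set"
    and u :: "nat \<Rightarrow> (real ^ 3 \<Rightarrow> real) set"
  defines "\<mu> \<equiv> surface_measure r \<Gamma>"
  assumes "r > 0" and "sphere_subdomain r \<Gamma>"
    and "N \<ge> 1"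
    and "inner_product ip"
    and "u\<^sub>0 \<in> L2 \<mu>" and "u\<xi> \<in> L2 \<mu>" and "\<epsilon> > 0"
    and "D u\<xi> = D u\<^sub>0 + \<xi>"
    and "ip_norm ip (D u\<^sub>0 - D u\<xi>) \<le> \<epsilon>"
    and "L2_subspace \<mu> V" and "L2_finite_dim \<mu> V"
    and "\<And>g g'. g \<in> V \<Longrightarrow> g' \<in> V \<Longrightarrow> L2_inner \<mu> g g' = ip (D g) (D g')"
    and "\<And>k. k \<in> {1..N} \<Longrightarrow> u k \<in> V"
    and "k\<^sub>o\<^sub>p\<^sub>t \<in> {1..N}"
    and "L2_norm \<mu> (L2_diff \<mu> u\<^sub>0 (u k\<^sub>o\<^sub>p\<^sub>t)) = Min ((\<lambda>k. L2_norm \<mu> (L2_diff \<mu> u\<^sub>0 (u k))) ` {1..N})"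
    and "k\<^sub>s \<in> {1..N}"
    and "H_val \<mu> ip D N u u\<xi> k\<^sub>s = Min ((\<lambda>k. H_val \<mu> ip D N u u\<xi> k) ` {1..N})"
  shows "L2_norm \<mu> (L2_diff \<mu> u\<^sub>0 (u k\<^sub>s))
       \<le> L2_norm \<mu> (L2_diff \<mu> u\<^sub>0 (u k\<^sub>o\<^sub>p\<^sub>t)) + 2 * ip_norm ip (D u\<^sub>0 - D (u k\<^sub>o\<^sub>p\<^sub>t)) + 2 * \<epsilon>"
proof -
  note ip = \<open>inner_product ip\<close> and V = \<open>L2_subspace \<mu> V\<close>
    and iso = \<open>\<And>g g'. g \<in> V \<Longrightarrow> g' \<in> V \<Longrightarrow> L2_inner \<mu> g g' = ip (D g) (D g')\<close>
    and u = \<open>\<And>k. k \<in> {1..N} \<Longrightarrow> u k \<in> V\<close>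
    and opt = \<open>k\<^sub>o\<^sub>p\<^sub>t \<in> {1..N}\<close> and s = \<open>k\<^sub>s \<in> {1..N}\<close>
  let ?H = "H_val \<mu> ip D N u u\<xi>"
  \<comment> \<open>Half of the excess allowed in the conclusion; it will bound the value of
    \<open>?H\<close> at the optimal index.\<close>
  let ?E = "ip_norm ip (D u\<^sub>0 - D (u k\<^sub>o\<^sub>p\<^sub>t)) + \<epsilon>"
  have E_nonneg: "0 \<le> ?E"
    using \<open>\<epsilon> > 0\<close> by (simp add: ip_norm_def inner_product_nonneg[OF ip])
  have L2: "u k\<^sub>o\<^sub>p\<^sub>t \<in> L2 \<mu>" "u k\<^sub>s \<in> L2 \<mu>"
    using V u[OF opt] u[OF s] by (auto simp: L2_subspace_def)
  \<comment> \<open>The choice of \<open>k\<^sub>s\<close> enters here: it allows both values of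
    \<open>?H\<close> to be bounded through the optimal index.\<close>
  have "?H k\<^sub>s = Min (?H ` {1..N})" by fact
  also have "\<dots> \<le> ?H k\<^sub>o\<^sub>p\<^sub>t" using opt by simp
  finally have H_min: "?H k\<^sub>s \<le> ?H k\<^sub>o\<^sub>p\<^sub>t" .
  have "?H k\<^sub>o\<^sub>p\<^sub>t \<le> ip_norm ip (D (u k\<^sub>o\<^sub>p\<^sub>t) - D u\<xi>)"
    by (rule H_val_le_ip_norm[OF ip V iso u opt])
  also have "\<dots> \<le> ip_norm ip (D (u k\<^sub>o\<^sub>p\<^sub>t) - D u\<^sub>0) + ip_norm ip (D u\<^sub>0 - D u\<xi>)"
    using ip_norm_triangle[OF ip, of "D (u k\<^sub>o\<^sub>p\<^sub>t) - D u\<^sub>0" "D u\<^sub>0 - D u\<xi>"] by simp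
  also have "\<dots> \<le> ?E"
    using \<open>ip_norm ip (D u\<^sub>0 - D u\<xi>) \<le> \<epsilon>\<close>
    by (simp add: ip_norm_minus_commute[OF ip, of "D (u k\<^sub>o\<^sub>p\<^sub>t)"])
  finally have H_opt: "?H k\<^sub>o\<^sub>p\<^sub>t \<le> ?E" .
  have "L2_norm \<mu> (L2_diff \<mu> (u k\<^sub>o\<^sub>p\<^sub>t) (u k\<^sub>s)) \<le> 2 * ?E"
  \<comment> \<open>Distinct indices may carry the same approximation, and then no normalised
    difference exists in \<open>A_set\<close>.\<close>
  proof (cases "u k\<^sub>o\<^sub>p\<^sub>t = u k\<^sub>s")
    case True
    then have "L2_norm \<mu> (L2_diff \<mu> (u k\<^sub>o\<^sub>p\<^sub>t) (u k\<^sub>s)) = 0"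
      using L2 by (simp add: L2_norm_diff_eq_0_iff)
    then show ?thesis using E_nonneg by simp
  next
    case False
    have "L2_norm \<mu> (L2_diff \<mu> (u k\<^sub>o\<^sub>p\<^sub>t) (u k\<^sub>s)) \<le> ?H k\<^sub>o\<^sub>p\<^sub>t + ?H k\<^sub>s"
      by (rule L2_norm_diff_le_H_val[OF V u opt s False])
    then show ?thesis using H_min H_opt by argo
  qed
  \<comment> \<open>Triangle inequality from \<open>u\<^sub>0\<close> to \<open>u k\<^sub>s\<close>
    through \<open>u k\<^sub>o\<^sub>p\<^sub>t\<close>.\<close>
  then show ?thesis
    using L2_norm_diff_triangle[OF \<open>u\<^sub>0 \<in> L2 \<mu>\<close> L2] by argo
qed

end
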